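(* There is an infinite class $\mathcal C$ of acyclic conjunctive regular path queries (CRPQs) such that the contraction width of the queries in $\mathcal C$ is bounded, i.e., there is a constant $c$ with $\mathsf{cw}(Q)\le c$ for all $Q\in\mathcal C$, but their free-connex fractional hypertree width is unbounded, i.e., $\sup_{Q\in\mathcal C}\mathsf{w}(Q)=\infty$.
   Context: **Queries.** A regular path query (RPQ) over a finite alphabet $\Sigma$ is a regular expression over $\Sigma$. A CRPQ has the form $Q(\boldsymbol F)=r_1(X_1,Y_1)\wedge\cdots\wedge r_n(X_n,Y_n)$, where each $r_i$ is an RPQ, each $r_i(X_i,Y_i)$ is called an atom, $\mathrm{atoms}(Q)$ is the set of atoms, $\mathrm{vars}(Q)=\{X_i,Y_i\mid i\in\{1,\ldots,n\}\}$, $\mathrm{free}(Q)=\boldsymbol F\subseteq \mathrm{vars}(Q)$ are the free variables, and $\mathrm{bound}(Q)=\mathrm{vars}(Q)\setminus\mathrm{free}(Q)$ are the bound variables. The conjunction of atoms is the body of $Q$. The query graph $G_Q$ is the undirected multigraph with vertex set $\mathrm{vars}(Q)$ and one edge $\{X_i,Y_i\}$ per atom. $Q$ is acyclic if $G_Q$ is a forest (no cycles, self-loops or parallel edges). **Contracted query graph.** For a cycle-free undirected graph $H=(V_H,E_H)$, two elimination operations are defined. (i) A vertex $u$ of degree 2 with neighbors $v_1\neq v_2$: remove $u$ and the edges $\{u,v_1\},\{u,v_2\}$ and add the edge $\{v_1,v_2\}$. (ii) A vertex $u$ of degree 1 with neighbor $v$: remove $u$ and the edge $\{u,v\}$, and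 also remove $v$ if $v$ has no neighbor other than $u$. Let $\mathrm{eliminate}(H,u)$ be the resulting graph. An elimination order for an acyclic CRPQ $Q$ is a sequence $(X_1,\ldots,X_k)$ of bound variables for which there are graphs $G_0=G_Q$ and $G_i=\mathrm{eliminate}(G_{i-1},X_i)$ for $i\in\{1,\ldots,k\}$ such that all bound variables in $G_k$ have degree at least 3. The graph $G_k$ does not depend on the elimination order; it is called the contracted query graph of $Q$ and denoted $\mathsf{cg}(Q)$. **Tree decompositions and contraction width.** A tree decomposition of $Q$ is a pair $\mathcal T=(T,\chi)$ with $T$ a tree and $\chi:V(T)\to 2^{\mathrm{vars}(Q)}$ such that for every atom $r(X,Y)$ there is $t$ with $X,Y\in\chi(t)$, and for every variable $X$ the set $\{t\mid X\in\chi(t)\}$ is a non-empty connected subtree of $T$. The sets $\chi(t)$ are the bags. $\mathcal T$ is free-connex if $T$ contains a connected subtree such that the union of the bags in it is exactly $\mathrm{free}(Q)$; $\mathsf{FTD}(Q)$ is the set of free-connex tree decompositions of $Q$. The CRPQ $Q_{\mathcal B}$ induced by a bag $\mathcal B$ has the same body as $Q$ and free variables $\mathrm{free}(Q)\cap\mathcal B$. Define $$\mathsf{cw}(Q)=\min_{\mathcal T\in\mathsf{FTD}(Q)}\mathsf{cw}(\mathcal T),\qquad \mathsf{cw}(\mathcal T)=\max_{\mathcal B\in\mathrm{bags}(\mathcal T)}|\mathrm{bound}(\mathsf{cg}(Q_{\mathcal B}))|,$$ where $\mathrm{bound}(\mathsf{cg}(Q_{\mathcal B}))$ is the set of bound variables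 of $Q_{\mathcal B}$ that occur as vertices in $\mathsf{cg}(Q_{\mathcal B})$. **Free-connex fractional hypertree width.** For $\boldsymbol S\subseteq\mathrm{vars}(Q)$, the fractional edge cover number $\rho^*_Q(\boldsymbol S)$ is the minimum of $\sum_{r(\boldsymbol X)\in\mathrm{atoms}(Q)}\lambda_{r(\boldsymbol X)}$ over all $\lambda_{r(\boldsymbol X)}\in[0,1]$ satisfying $\sum_{r(\boldsymbol X):\,X\in\boldsymbol X}\lambda_{r(\boldsymbol X)}\ge 1$ for every $X\in\boldsymbol S$. Define $$\mathsf{w}(Q)=\min_{\mathcal T\in\mathsf{FTD}(Q)}\ \max_{\mathcal B\in\mathrm{bags}(\mathcal T)}\rho^*_Q(\mathcal B).$$ *)

theory Defs
  imports
    Complex_Main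
    "HOL-Library.Multiset"
    "HOL-Library.Uprod"
    "HOL-Library.Extended_Real"
begin

section \<open>Undirected multigraphs\<close>

record 'v multigraph =
  verts :: "'v set"
  edges :: "'v uprod multiset"

definition wf_multigraph :: "'v multigraph \<Rightarrow> bool" where
  "wf_multigraph G \<longleftrightarrow> (\<forall>e \<in># edges G. set_uprod e \<subseteq> verts G)"

definition neighbors :: "'v multigraph \<Rightarrow> 'v \<Rightarrow> 'v set" where
  "neighbors G u = {v. Upair u v \<in># edges G}"

text \<open>A self-loop contributes 2 to the degree.\<close>

definition degree :: "'v multigraph \<Rightarrow> 'v \<Rightarrow> nat" where
  "degree G u = size {#e \<in># edges G. u \<in> set_uprod e#} + count (edges G) (Upair u u)"

text \<open>
  A cycle visits distinct vertices and traverses distinct edges; the latter is what the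
  sub-multiset condition says. A list of length 1 is a cycle iff the vertex has a self-loop,
  a list of length 2 iff its vertices are joined by parallel edges.
\<close>

definition is_cycle :: "'v multigraph \<Rightarrow> 'v list \<Rightarrow> bool" where
  "is_cycle G vs \<longleftrightarrow>
     vs \<noteq> [] \<and> distinct vs \<and> mset (map2 Upair vs (rotate1 vs)) \<subseteq># edges G"

definition cycle_free :: "'v multigraph \<Rightarrow> bool" where
  "cycle_free G \<longleftrightarrow> (\<nexists>vs. is_cycle G vs)"

text \<open>
  \<open>S\<close> is a nonempty set of vertices inducing a connected subgraph. For a tree \<open>G\<close>, these are
  exactly the vertex sets of the (connected) subtrees of \<open>G\<close>.
\<close>

definition connected_in :: "'v multigraph \<Rightarrow> 'v set \<Rightarrow> bool" where
  "connected_in G S \<longleftrightarrow>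
     S \<noteq> {} \<and> S \<subseteq> verts G \<and>
     (\<forall>x\<in>S. \<forall>y\<in>S. (x, y) \<in> {(a, b). a \<in> S \<and> b \<in> S \<and> Upair a b \<in># edges G}\<^sup>*)"

definition is_tree :: "'v multigraph \<Rightarrow> bool" where
  "is_tree T \<longleftrightarrow>
     finite (verts T) \<and> wf_multigraph T \<and> connected_in T (verts T) \<and> cycle_free T"


section \<open>Conjunctive regular path queries\<close>

datatype 'a rpq =
    Empty
  | Epsilon
  | Letter 'a
  | Alt "'a rpq" "'a rpq"
  | Concat "'a rpq" "'a rpq"
  | Star "'a rpq"

datatype ('v, 'a) atom = Atom (rpq_of: "'a rpq") (source: 'v) (target: 'v)

definition vars_atom :: "('v, 'a) atom \<Rightarrow> 'v set" where
  "vars_atom A = {source A, target A}"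

record ('v, 'a) crpq =
  body :: "('v, 'a) atom list"
  free :: "'v set"

definition atoms :: "('v, 'a) crpq \<Rightarrow> ('v, 'a) atom set" where
  "atoms Q = set (body Q)"

definition vars :: "('v, 'a) crpq \<Rightarrow> 'v set" where
  "vars Q = (\<Union>A\<in>atoms Q. vars_atom A)"

definition bound :: "('v, 'a) crpq \<Rightarrow> 'v set" where
  "bound Q = vars Q - free Q"

definition is_crpq :: "('v, 'a) crpq \<Rightarrow> bool" where
  "is_crpq Q \<longleftrightarrow> body Q \<noteq> [] \<and> free Q \<subseteq> vars Q"

definition query_graph :: "('v, 'a) crpq \<Rightarrow> 'v multigraph" where
  "query_graph Q =
     \<lparr>verts = vars Q,
      edges = image_mset (\<lambda>A. Upair (source A) (target A)) (mset_set (atoms Q))\<rparr>"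

definition acyclic_crpq :: "('v, 'a) crpq \<Rightarrow> bool" where
  "acyclic_crpq Q \<longleftrightarrow> cycle_free (query_graph Q)"


section \<open>The contracted query graph\<close>

text \<open>
  \<open>eliminate H u H'\<close>: the graph \<open>H'\<close> is the result of eliminating \<open>u\<close> from the cycle-free
  graph \<open>H\<close>. It is a relation because elimination is defined for vertices of degree 1 or 2 only.
\<close>

inductive eliminate :: "'v multigraph \<Rightarrow> 'v \<Rightarrow> 'v multigraph \<Rightarrow> bool" where
  degree_two:
    "\<lbrakk>u \<in> verts H; degree H u = 2; neighbors H u = {v1, v2}; v1 \<noteq> v2\<rbrakk> \<Longrightarrow>
     eliminate H u
       \<lparr>verts = verts H - {u},
        edges = edges H - {#Upair u v1, Upair u v2#} + {#Upair v1 v2#}\<rparr>"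
| degree_one:
    "\<lbrakk>u \<in> verts H; degree H u = 1; neighbors H u = {v}\<rbrakk> \<Longrightarrow>
     eliminate H u
       \<lparr>verts = verts H - {u} - (if neighbors H v = {u} then {v} else {}),
        edges = edges H - {#Upair u v#}\<rparr>"

definition elimination_order ::
  "('v, 'a) crpq \<Rightarrow> 'v list \<Rightarrow> 'v multigraph \<Rightarrow> bool" where
  "elimination_order Q Xs H \<longleftrightarrow>
     set Xs \<subseteq> bound Q \<and>
     (\<exists>G. G 0 = query_graph Q \<and>
          (\<forall>i<length Xs. eliminate (G i) (Xs ! i) (G (Suc i))) \<and>
          G (length Xs) = H) \<and>
     (\<forall>X \<in> bound Q \<inter> verts H. degree H X \<ge> 3)"

text \<open>
  For acyclic \<open>Q\<close> an elimination order exists and the final graph does not depend on it.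
  The definition is meaningful for acyclic \<open>Q\<close> only.
\<close>

definition cg :: "('v, 'a) crpq \<Rightarrow> 'v multigraph" where
  "cg Q = (THE H. \<exists>Xs. elimination_order Q Xs H)"


section \<open>Free-connex tree decompositions\<close>

definition tree_decomposition ::
  "('v, 'a) crpq \<Rightarrow> 't multigraph \<Rightarrow> ('t \<Rightarrow> 'v set) \<Rightarrow> bool" where
  "tree_decomposition Q T \<chi> \<longleftrightarrow>
     is_tree T \<and>
     (\<forall>t\<in>verts T. \<chi> t \<subseteq> vars Q) \<and>
     (\<forall>A\<in>atoms Q. \<exists>t\<in>verts T. source A \<in> \<chi> t \<and> target A \<in> \<chi> t) \<and>
     (\<forall>X\<in>vars Q. connected_in T {t \<in> verts T. X \<in> \<chi> t})"

definition free_connex ::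
  "('v, 'a) crpq \<Rightarrow> 't multigraph \<Rightarrow> ('t \<Rightarrow> 'v set) \<Rightarrow> bool" where
  "free_connex Q T \<chi> \<longleftrightarrow> (\<exists>S. connected_in T S \<and> (\<Union>t\<in>S. \<chi> t) = free Q)"

text \<open>The trees are finite, so natural numbers suffice as nodes.\<close>

definition FTD :: "('v, 'a) crpq \<Rightarrow> (nat multigraph \<times> (nat \<Rightarrow> 'v set)) set" where
  "FTD Q = {(T, \<chi>). tree_decomposition Q T \<chi> \<and> free_connex Q T \<chi>}"

definition bags :: "nat multigraph \<times> (nat \<Rightarrow> 'v set) \<Rightarrow> 'v set set" where
  "bags \<T> = snd \<T> ` verts (fst \<T>)"


section \<open>Width measures\<close>

definition induced_crpq :: "('v, 'a) crpq \<Rightarrow> 'v set \<Rightarrow> ('v, 'a) crpq" where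
  "induced_crpq Q B = \<lparr>body = body Q, free = free Q \<inter> B\<rparr>"

definition bound_cg :: "('v, 'a) crpq \<Rightarrow> 'v set" where
  "bound_cg Q = bound Q \<inter> verts (cg Q)"

definition cw_decomp ::
  "('v, 'a) crpq \<Rightarrow> nat multigraph \<times> (nat \<Rightarrow> 'v set) \<Rightarrow> nat" where
  "cw_decomp Q \<T> = (MAX B\<in>bags \<T>. card (bound_cg (induced_crpq Q B)))"

definition cw :: "('v, 'a) crpq \<Rightarrow> nat" where
  "cw Q = (INF \<T>\<in>FTD Q. cw_decomp Q \<T>)"

text \<open>
  The infimum below is that of a linear program and is attained for \<open>S \<subseteq> vars Q\<close>;
  the ones in \<open>cw\<close> and \<open>fc_width\<close> are attained because \<open>FTD Q\<close> is nonempty (lemma \<open>FTD_nonempty\<close>)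
  and only finitely many values occur.
\<close>

definition fractional_edge_cover ::
  "('v, 'a) crpq \<Rightarrow> 'v set \<Rightarrow> (('v, 'a) atom \<Rightarrow> real) \<Rightarrow> bool" where
  "fractional_edge_cover Q S c \<longleftrightarrow>
     (\<forall>A\<in>atoms Q. 0 \<le> c A \<and> c A \<le> 1) \<and>
     (\<forall>X\<in>S. (\<Sum>A \<in> {A \<in> atoms Q. X \<in> vars_atom A}. c A) \<ge> 1)"

definition rho_star :: "('v, 'a) crpq \<Rightarrow> 'v set \<Rightarrow> real" where
  "rho_star Q S = Inf {\<Sum>A\<in>atoms Q. c A |c. fractional_edge_cover Q S c}"

definition w_decomp ::
  "('v, 'a) crpq \<Rightarrow> nat multigraph \<times> (nat \<Rightarrow> 'v set) \<Rightarrow> real" where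
  "w_decomp Q \<T> = (MAX B\<in>bags \<T>. rho_star Q B)"

definition fc_width :: "('v, 'a) crpq \<Rightarrow> real" where
  "fc_width Q = (INF \<T>\<in>FTD Q. w_decomp Q \<T>)"

lemma FTD_nonempty:
  fixes Q :: "('v, 'a) crpq"
  assumes "is_crpq Q"
  shows "FTD Q \<noteq> {}"
proof -
  define T :: "nat multigraph" where "T = \<lparr>verts = {0, 1}, edges = {#Upair 0 1#}\<rparr>"
  define \<chi> where "\<chi> = (\<lambda>t::nat. if t = 0 then free Q else vars Q)"
  have sub: "free Q \<subseteq> vars Q" using assms by (simp add: is_crpq_def)
  have c0: "connected_in T {0}" and c1: "connected_in T {1}"
    by (auto simp: connected_in_def T_def)
  have c01: "connected_in T {0, 1}"
    unfolding connected_in_def T_def by (auto intro!: r_into_rtrancl)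
  have "\<not> is_cycle T vs" for vs
  proof
    assume c: "is_cycle T vs"
    then have "size (mset (map2 Upair vs (rotate1 vs))) \<le> 1"
      unfolding is_cycle_def T_def by (auto dest: size_mset_mono)
    then have "length vs \<le> 1" by simp
    with c obtain a where "vs = [a]"
      unfolding is_cycle_def by (cases vs) auto
    with c show False by (auto simp: is_cycle_def T_def)
  qed
  then have "is_tree T"
    using c01 by (auto simp: is_tree_def cycle_free_def wf_multigraph_def T_def)
  moreover have "connected_in T {t \<in> verts T. X \<in> \<chi> t}" if "X \<in> vars Q" for X
  proof -
    have "{t \<in> verts T. X \<in> \<chi> t} = (if X \<in> free Q then {0, 1} else {1})"
      using that by (auto simp: T_def \<chi>_def)
    then show ?thesis using c01 c1 by simp
  qed
  moreover have "\<exists>t\<in>verts T. source A \<in> \<chi> t \<and> target A \<in> \<chi> t" if "A \<in> atoms Q" for A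
    using that by (auto simp: T_def \<chi>_def vars_def vars_atom_def)
  ultimately have "tree_decomposition Q T \<chi>"
    using sub by (auto simp: tree_decomposition_def \<chi>_def)
  moreover have "free_connex Q T \<chi>"
    unfolding free_connex_def using c0 by (auto simp: \<chi>_def intro!: exI[of _ "{0}"])
  ultimately show ?thesis by (auto simp: FTD_def)
qed

end

(* Take the stars r(0,1) /\ ... /\ r(0,n) whose leaves 1, ..., n are the free variables. With only
   the two bags free(Q) and vars(Q), every induced query is Q itself, whose only bound variable is
   the centre 0, so the contraction width is at most 1. Conversely, in a free-connex tree
   decomposition the subtree spanned by the free variables is disjoint from the subtree of the
   centre, while the subtree of every leaf meets both. As there is only one way to enter the former
   from the latter in a tree, all leaves share a bag; an atom covers only one leaf, so the
   fractional edge cover number of that bag is at least n. *)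

theory Submission
  imports Defs "HOL-Library.Transitive_Closure_Table"
begin

section \<open>Connected sets in cycle-free multigraphs\<close>

text \<open>Separates the closed edge list made with \<open>rotate1\<close> into the edges of an
  open path and the closing edge.\<close>

lemma map2_append_singleton:
  "map2 f (x # xs) (xs @ [z]) = map2 f (x # xs) xs @ [f (last (x # xs)) z]"
  by (induction xs arbitrary: x) auto

lemma rtrancl_path_last_Cons:
  "rtrancl_path r x xs y \<Longrightarrow> last (x # xs) = y"
  by (induction rule: rtrancl_path.induct) auto

lemma rtrancl_path_Upair_edges:
  assumes "rtrancl_path r x xs y"
  shows "set (map2 Upair (x # xs) xs) \<subseteq> {Upair a b |a b. r a b}"
  using assms by (induction rule: rtrancl_path.induct) auto

lemma set_uprod_map2_Upair:
  "e \<in> set (map2 Upair xs ys) \<Longrightarrow> set_uprod e \<subseteq> set xs \<union> set ys"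
  by (auto dest: set_zip_leftD set_zip_rightD)

text \<open>The first edge of a simple path contains its first vertex, which no later edge
  does.\<close>

lemma distinct_map2_Upair:
  "distinct (x # xs) \<Longrightarrow> distinct (map2 Upair (x # xs) xs)"
proof (induction xs arbitrary: x)
  case (Cons y ys)
  have "Upair x y \<notin> set (map2 Upair (y # ys) ys)"
  proof
    assume "Upair x y \<in> set (map2 Upair (y # ys) ys)"
    from set_uprod_map2_Upair[OF this] Cons.prems show False by simp
  qed
  with Cons show ?case by simp
qed simp

text \<open>Reduces the sub-multiset condition of \<open>is_cycle\<close> to an inclusion of
  sets.\<close>

lemma distinct_mset_subset_eq:
  assumes "distinct xs" "set xs \<subseteq> set_mset M"
  shows "mset xs \<subseteq># M"
  using assms
  by (auto simp: subseteq_mset_def distinct_count_atmost_1 Suc_le_eq)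

text \<open>Every edge of a forest is a bridge: a walk around it shortens to a simple path, which
  the edge closes to a cycle. For \<open>u = v\<close> the path is empty and the cycle is a
  self-loop.\<close>

lemma cycle_free_bridge:
  assumes "cycle_free G" and uv: "Upair u v \<in># edges G"
  shows "(u, v) \<notin> {(a, b). Upair a b \<in># edges G \<and> Upair a b \<noteq> Upair u v}\<^sup>*"
proof
  define r where "r = (\<lambda>a b. Upair a b \<in># edges G \<and> Upair a b \<noteq> Upair u v)"
  assume "(u, v) \<in> {(a, b). Upair a b \<in># edges G \<and> Upair a b \<noteq> Upair u v}\<^sup>*"
  then have "r\<^sup>*\<^sup>* u v"
    by (simp add: r_def rtranclp_rtrancl_eq)
  then obtain ys where "rtrancl_path r u ys v"
    by (auto simp: rtranclp_eq_rtrancl_path)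
  then obtain xs where path: "rtrancl_path r u xs v" and dist: "distinct (u # xs)"
    by (rule rtrancl_path_distinct)
  let ?es = "map2 Upair (u # xs) xs"
  have "set ?es \<subseteq> {Upair a b |a b. r a b}"
    by (rule rtrancl_path_Upair_edges[OF path])
  also have "\<dots> \<subseteq> {e. e \<in># edges G \<and> e \<noteq> Upair u v}"
    by (auto simp: r_def simp del: Upair_inject)
  finally have es: "set ?es \<subseteq> {e. e \<in># edges G \<and> e \<noteq> Upair u v}" .
  have cyc: "map2 Upair (u # xs) (rotate1 (u # xs)) = ?es @ [Upair u v]"
    unfolding rotate1.simps map2_append_singleton rtrancl_path_last_Cons[OF path]
    by simp
  have "mset (map2 Upair (u # xs) (rotate1 (u # xs))) \<subseteq># edges G"
    unfolding cyc by (rule distinct_mset_subset_eq) (use es uv distinct_map2_Upair[OF dist] in auto)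
  then have "is_cycle G (u # xs)"
    using dist by (auto simp: is_cycle_def)
  with \<open>cycle_free G\<close> show False
    by (auto simp: cycle_free_def)
qed

text \<open>Cuts the walk at its first vertex in \<open>S\<close>. The outside part forgets
  \<open>P\<close>, so that outside parts for different sets \<open>P\<close> can be
  concatenated.\<close>

lemma rtrancl_first_entry:
  assumes "(x, y) \<in> {(a, b). a \<in> P \<and> b \<in> P \<and> E a b}\<^sup>*" "x \<notin> S" "y \<in> S"
  obtains u s where "(x, u) \<in> {(a, b). a \<notin> S \<and> b \<notin> S \<and> E a b}\<^sup>*"
    "E u s" "u \<notin> S" "s \<in> S \<inter> P"
proof -
  have "\<exists>u s. (x, u) \<in> {(a, b). a \<notin> S \<and> b \<notin> S \<and> E a b}\<^sup>* \<and> E u s \<and> u \<notin> S \<and> s \<in> S \<inter> P"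
    using assms
  proof (induction rule: converse_rtrancl_induct)
    case (step x z)
    show ?case
    proof (cases "z \<in> S")
      case True
      with step show ?thesis by blast
    next
      case False
      with step obtain u s where us: "(z, u) \<in> {(a, b). a \<notin> S \<and> b \<notin> S \<and> E a b}\<^sup>*"
        "E u s" "u \<notin> S" "s \<in> S \<inter> P" by blast
      have "(x, z) \<in> {(a, b). a \<notin> S \<and> b \<notin> S \<and> E a b}"
        using step False by auto
      with us show ?thesis by (meson converse_rtrancl_into_rtrancl)
    qed
  qed simp
  with that show thesis by blast
qed

text \<open>Otherwise the walk from \<open>u\<close> to \<open>u'\<close> outside \<open>S\<close>,
  then into \<open>s'\<close>, then inside \<open>S\<close> to \<open>s\<close> would bypass the
  edge between \<open>u\<close> and \<open>s\<close>, which is a bridge.\<close>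

lemma cycle_free_unique_gate:
  assumes cf: "cycle_free G" and S: "connected_in G S"
    and u: "u \<notin> S" "s \<in> S" "Upair u s \<in># edges G"
    and u': "u' \<notin> S" "s' \<in> S" "Upair u' s' \<in># edges G"
    and outside: "(u, u') \<in> {(a, b). a \<notin> S \<and> b \<notin> S \<and> Upair a b \<in># edges G}\<^sup>*"
  shows "s = s'"
proof (rule ccontr)
  assume neq: "s \<noteq> s'"
  let ?r = "{(a, b). Upair a b \<in># edges G \<and> Upair a b \<noteq> Upair u s}"
  have "{(a, b). a \<notin> S \<and> b \<notin> S \<and> Upair a b \<in># edges G} \<subseteq> ?r"
    using u by auto
  with outside have "(u, u') \<in> ?r\<^sup>*"
    using rtrancl_mono by blast
  also have "(u', s') \<in> ?r"
    using u u' neq by auto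
  also have "(s', s) \<in> {(a, b). a \<in> S \<and> b \<in> S \<and> Upair a b \<in># edges G}\<^sup>*"
    using S u u' by (auto simp: connected_in_def)
  then have "(s', s) \<in> ?r\<^sup>*"
    by (rule rtrancl_mono[THEN subsetD, rotated]) (use u in auto)
  finally show False
    using cycle_free_bridge[OF cf u(3)] by blast
qed

text \<open>Each \<open>P i\<close> has a vertex where \<open>S\<close> is entered by a walk that
  starts in \<open>R\<close> and stays outside \<open>S\<close> until then; as \<open>R\<close> is
  connected and misses \<open>S\<close>, all these entry vertices coincide.\<close>

lemma cycle_free_common_vertex:
  assumes cf: "cycle_free G" and R: "connected_in G R" and S: "connected_in G S"
    and disj: "R \<inter> S = {}"
    and P: "\<And>i. i \<in> I \<Longrightarrow> connected_in G (P i)"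
    and PR: "\<And>i. i \<in> I \<Longrightarrow> P i \<inter> R \<noteq> {}"
    and PS: "\<And>i. i \<in> I \<Longrightarrow> P i \<inter> S \<noteq> {}"
  shows "\<exists>s\<in>S. \<forall>i\<in>I. s \<in> P i"
proof -
  let ?O = "{(a, b). a \<notin> S \<and> b \<notin> S \<and> Upair a b \<in># edges G}"
  have sym_O: "sym ?O"
  proof (rule symI)
    fix a b assume "(a, b) \<in> ?O"
    moreover have "Upair b a = Upair a b" by simp
    ultimately show "(b, a) \<in> ?O" by (simp only: mem_Collect_eq case_prod_conv) simp
  qed
  have gate: "\<exists>r u s. r \<in> R \<and> (r, u) \<in> ?O\<^sup>* \<and> u \<notin> S \<and> s \<in> S \<inter> P i \<and> Upair u s \<in># edges G"
    if i: "i \<in> I" for i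
  proof -
    obtain x y where "x \<in> P i \<inter> R" "y \<in> P i \<inter> S"
      using PR[OF i] PS[OF i] by blast
    moreover from this have "(x, y) \<in> {(a, b). a \<in> P i \<and> b \<in> P i \<and> Upair a b \<in># edges G}\<^sup>*"
      using P[OF i] by (auto simp: connected_in_def)
    ultimately show ?thesis
      using disj by (elim rtrancl_first_entry[where S = S]) blast+
  qed
  show ?thesis
  proof (cases "I = {}")
    case True
    with S show ?thesis by (auto simp: connected_in_def)
  next
    case False
    then obtain j where "j \<in> I" by blast
    from gate[OF this] obtain r u s where j: "r \<in> R" "(r, u) \<in> ?O\<^sup>*" "u \<notin> S" "s \<in> S"
      "Upair u s \<in># edges G" by blast
    have "s \<in> P i" if "i \<in> I" for i
    proof -
      from gate[OF that] obtain r' u' s' where i: "r' \<in> R" "(r', u') \<in> ?O\<^sup>*" "u' \<notin> S" "s' \<in> S"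
        "s' \<in> P i" "Upair u' s' \<in># edges G" by blast
      \<comment> \<open>From \<open>u\<close> back to \<open>R\<close>, across \<open>R\<close> and
        on to \<open>u'\<close>, never meeting \<open>S\<close>.\<close>
      have "(u, r) \<in> ?O\<^sup>*"
        using j(2) sym_rtrancl[OF sym_O] by (meson symD)
      also have "(r, r') \<in> {(a, b). a \<in> R \<and> b \<in> R \<and> Upair a b \<in># edges G}\<^sup>*"
        using R j(1) i(1) by (auto simp: connected_in_def)
      then have "(r, r') \<in> ?O\<^sup>*"
        by (rule rtrancl_mono[THEN subsetD, rotated]) (use disj in auto)
      also note i(2)
      finally have "s = s'"
        using cycle_free_unique_gate[OF cf S j(3,4,5) i(3,4,6)] by blast
      with i show ?thesis by simp
    qed
    with j show ?thesis by blast
  qed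
qed

section \<open>Star queries\<close>

text \<open>For \<open>n = 0\<close> the body is empty: the query is no CRPQ and lacks the centre 0,
  hence the assumption \<open>n \<ge> 1\<close> in many lemmas below.\<close>

definition star_query :: "'a rpq \<Rightarrow> nat \<Rightarrow> (nat, 'a) crpq" where
  "star_query r n = \<lparr>body = map (Atom r 0) [1..<Suc n], free = {1..n}\<rparr>"

lemma atoms_star_query: "atoms (star_query r n) = Atom r 0 ` {1..n}"
  by (simp add: atoms_def star_query_def atLeastLessThanSuc_atLeastAtMost del: upt_Suc)

lemma free_star_query: "free (star_query r n) = {1..n}"
  by (simp add: star_query_def)

lemma vars_star_query: "n \<ge> 1 \<Longrightarrow> vars (star_query r n) = {0..n}"
  by (force simp: vars_def atoms_star_query vars_atom_def)

lemma is_crpq_star_query: "n \<ge> 1 \<Longrightarrow> is_crpq (star_query r n)"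
  by (simp add: is_crpq_def free_star_query vars_star_query) (simp add: star_query_def)

text \<open>Injectivity of both maps makes all multiplicities 1, which later excludes parallel
  edges.\<close>

lemma edges_star_query:
  "edges (query_graph (star_query r n)) = mset_set (Upair 0 ` {1..n})"
proof -
  have "inj_on (Atom r 0) {1..n}" "inj_on (Upair 0) {1..n}"
    by (auto simp: inj_on_def)
  then show ?thesis
    by (simp add: query_graph_def atoms_star_query flip: image_mset_mset_set)
      (simp add: multiset.map_comp comp_def)
qed

text \<open>Every edge joins the centre to a leaf, so a cycle would have to pass through the centre
  at every second vertex, yet it visits the centre at most once.\<close>

lemma acyclic_star_query: "acyclic_crpq (star_query r n)"
proof -
  let ?E = "mset_set (Upair 0 ` {1..n})"
  have "\<not> is_cycle (query_graph (star_query r n)) vs" for vs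
  proof
    assume "is_cycle (query_graph (star_query r n)) vs"
    then have vs: "vs \<noteq> []" "distinct vs" and sub: "mset (map2 Upair vs (rotate1 vs)) \<subseteq># ?E"
      by (auto simp: is_cycle_def edges_star_query)
    have edge: "(a = 0) \<noteq> (b = 0)" if "Upair a b \<in> set (map2 Upair vs (rotate1 vs))" for a b
      using mset_subset_eqD[OF sub] that by force
    consider a where "vs = [a]" | a b where "vs = [a, b]"
      | a b c ws where "vs = a # b # c # ws"
      using vs(1) by (metis list.exhaust)
    then show False
    proof cases
      case 1
      then show False using edge[of a a] by simp
    next
      case (2 a b)
      \<comment> \<open>Both steps of the cycle use the same unordered edge.\<close>
      then have "count (mset (map2 Upair vs (rotate1 vs))) (Upair a b) = 2"
        by simp
      moreover have "count ?E (Upair a b) \<le> 1"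
        by (simp add: count_mset_set')
      ultimately show False
        using mset_subset_eq_count[OF sub, of "Upair a b"] by simp
    next
      case (3 a b c ws)
      then have "b = 0"
        using edge[of a b] edge[of b c] vs(2) by auto
      \<comment> \<open>\<open>d\<close> follows \<open>c\<close> on the cycle; it is
        \<open>a\<close> if \<open>ws\<close> is empty. As \<open>c\<close> is a leaf,
        \<open>d\<close> would be the centre \<open>b\<close> again.\<close>
      moreover obtain d ds where "ws @ [a] = d # ds" "d \<in> insert a (set ws)"
        by (cases ws) auto
      ultimately show False
        using 3 edge[of c d] edge[of b c] vs(2) by auto
    qed
  qed
  then show ?thesis
    by (simp add: acyclic_crpq_def cycle_free_def)
qed

lemma inj_star_query: "inj (star_query r)"
proof (rule injI)
  fix m n
  assume "star_query r m = star_query r n"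
  then have "{1..m} = {1..n}"
    by (metis free_star_query)
  then show "m = n"
    by (metis card_atLeastAtMost diff_Suc_1)
qed

lemma finite_vars: "finite (vars Q)"
  by (simp add: vars_def atoms_def vars_atom_def)

text \<open>A bag containing \<open>free Q\<close> leaves the bound variables of \<open>Q\<close>
  unchanged, and \<open>bound_cg\<close> selects among these, whatever \<open>cg\<close> is.\<close>

lemma card_bound_cg_induced_le:
  assumes "free Q \<subseteq> B"
  shows "card (bound_cg (induced_crpq Q B)) \<le> card (bound Q)"
proof (rule card_mono)
  show "finite (bound Q)"
    by (simp add: bound_def finite_vars)
  show "bound_cg (induced_crpq Q B) \<subseteq> bound Q"
    using assms by (auto simp: bound_cg_def bound_def induced_crpq_def vars_def atoms_def)
qed

section \<open>Contraction width\<close>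

lemma cw_le_card_bound:
  assumes "is_crpq Q"
  shows "cw Q \<le> card (bound Q)"
proof -
  \<comment> \<open>The star with one leaf doubles as the two-node decomposition tree, so
    \<open>acyclic_star_query\<close> shows that it is cycle-free.\<close>
  define T where "T = query_graph (star_query Epsilon 1)"
  define \<chi> where "\<chi> = (\<lambda>t::nat. if t = 0 then free Q else vars Q)"
  have vT: "verts T = {0, 1}"
    using vars_star_query[of 1 Epsilon]
    by (simp add: T_def query_graph_def atLeast0_atMost_Suc insert_commute)
  have eT: "edges T = {#Upair 0 1#}"
    unfolding T_def edges_star_query by simp
  have sub: "free Q \<subseteq> vars Q"
    using assms by (simp add: is_crpq_def)
  have con: "connected_in T {0}" "connected_in T {1}" "connected_in T {0, 1}"
    by (auto simp: connected_in_def vT eT intro!: r_into_rtrancl)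
  have "cycle_free T"
    using acyclic_star_query unfolding T_def acyclic_crpq_def .
  then have "is_tree T"
    using con(3) by (simp add: is_tree_def wf_multigraph_def vT eT)
  moreover have "connected_in T {t \<in> verts T. X \<in> \<chi> t}" if "X \<in> vars Q" for X
  proof -
    have "{t \<in> verts T. X \<in> \<chi> t} = (if X \<in> free Q then {0, 1} else {1})"
      using that by (auto simp: vT \<chi>_def)
    then show ?thesis using con by simp
  qed
  ultimately have "tree_decomposition Q T \<chi>"
    using sub by (auto simp: tree_decomposition_def vT \<chi>_def vars_def vars_atom_def)
  moreover have "free_connex Q T \<chi>"
    unfolding free_connex_def using con(1) by (intro exI[of _ "{0}"]) (simp add: \<chi>_def)
  ultimately have "(T, \<chi>) \<in> FTD Q"
    by (simp add: FTD_def)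
  then have "cw Q \<le> cw_decomp Q (T, \<chi>)"
    unfolding cw_def by (simp add: cINF_lower)
  also have "\<dots> \<le> card (bound Q)"
    unfolding cw_decomp_def bags_def using sub
    by (simp add: vT \<chi>_def card_bound_cg_induced_le)
  finally show ?thesis .
qed

lemma cw_star_query_le:
  assumes "n \<ge> 1"
  shows "cw (star_query r n) \<le> 1"
proof -
  have "bound (star_query r n) = {0}"
    using assms by (auto simp: bound_def vars_star_query free_star_query)
  then show ?thesis
    using cw_le_card_bound[OF is_crpq_star_query[OF assms, of r]] by simp
qed

section \<open>Free-connex fractional hypertree width\<close>

lemma star_query_leaves_in_bag:
  assumes n: "n \<ge> 1" and "(T, \<chi>) \<in> FTD (star_query r n)"
  shows "\<exists>t\<in>verts T. {1..n} \<subseteq> \<chi> t"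
proof -
  let ?Q = "star_query r n"
  let ?N = "\<lambda>X. {t \<in> verts T. X \<in> \<chi> t}"
  from assms have td: "tree_decomposition ?Q T \<chi>" and "free_connex ?Q T \<chi>"
    by (auto simp: FTD_def)
  then obtain S where S: "connected_in T S" and SF: "(\<Union>t\<in>S. \<chi> t) = {1..n}"
    by (auto simp: free_connex_def free_star_query)
  have SV: "S \<subseteq> verts T"
    using S by (simp add: connected_in_def)
  have conn: "connected_in T (?N X)" if "X \<le> n" for X
    using td that n by (simp add: tree_decomposition_def vars_star_query)
  \<comment> \<open>The subtree of the centre serves as \<open>R\<close> and misses
    \<open>S\<close>, since 0 is not free. The subtree of leaf \<open>i\<close> meets it by the atom
    on 0 and \<open>i\<close>, and meets \<open>S\<close> because \<open>i\<close> is free.\<close>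
  have "\<exists>s\<in>S. \<forall>i\<in>{1..n}. s \<in> ?N i"
  proof (rule cycle_free_common_vertex[where R = "?N 0"])
    show "cycle_free T"
      using td by (simp add: tree_decomposition_def is_tree_def)
    show "?N 0 \<inter> S = {}"
      using SF by force
    fix i assume i: "i \<in> {1..n}"
    show "?N i \<inter> ?N 0 \<noteq> {}"
      using td i by (fastforce simp: tree_decomposition_def atoms_star_query)
    show "?N i \<inter> S \<noteq> {}"
      using i SF SV by blast
    show "connected_in T (?N i)"
      using i by (simp add: conn)
  qed (use S conn in auto)
  with SV show ?thesis by blast
qed

lemma rho_star_star_query_ge:
  assumes "n \<ge> 1" "{1..n} \<subseteq> B" "B \<subseteq> {0..n}"
  shows "real n \<le> rho_star (star_query r n) B"
  unfolding rho_star_def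
proof (rule cInf_greatest)
  let ?Q = "star_query r n"
  have fin: "finite (atoms ?Q)"
    by (simp add: atoms_star_query)
  \<comment> \<open>\<open>cInf_greatest\<close> asks for some cover; weight 1 everywhere is one, as
    each variable of \<open>B\<close> lies in an atom.\<close>
  have "fractional_edge_cover ?Q B (\<lambda>_. 1)"
    unfolding fractional_edge_cover_def
  proof (intro conjI ballI)
    fix X assume "X \<in> B"
    with assms have "X \<in> vars ?Q"
      by (auto simp: vars_star_query)
    then have "{A \<in> atoms ?Q. X \<in> vars_atom A} \<noteq> {}"
      by (auto simp: vars_def)
    then have "card {A \<in> atoms ?Q. X \<in> vars_atom A} \<ge> 1"
      using fin by (simp add: Suc_le_eq card_gt_0_iff)
    then show "1 \<le> (\<Sum>A \<in> {A \<in> atoms ?Q. X \<in> vars_atom A}. 1::real)"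
      by simp
  qed auto
  then show "{\<Sum>A\<in>atoms ?Q. c A |c. fractional_edge_cover ?Q B c} \<noteq> {}"
    by blast
  fix x assume "x \<in> {\<Sum>A\<in>atoms ?Q. c A |c. fractional_edge_cover ?Q B c}"
  then obtain c where x: "x = (\<Sum>A\<in>atoms ?Q. c A)" and c: "fractional_edge_cover ?Q B c"
    by blast
  have "1 \<le> c (Atom r 0 i)" if i: "i \<in> {1..n}" for i
  proof -
    \<comment> \<open>Leaf \<open>i\<close> lies in a single atom, which must cover it
      alone.\<close>
    have "{A \<in> atoms ?Q. i \<in> vars_atom A} = {Atom r 0 i}"
      using i by (auto simp: atoms_star_query vars_atom_def)
    moreover have "i \<in> B"
      using i assms by blast
    ultimately show ?thesis
      using c by (fastforce simp: fractional_edge_cover_def)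
  qed
  then have "(\<Sum>i\<in>{1..n}. 1) \<le> (\<Sum>i\<in>{1..n}. c (Atom r 0 i))"
    by (intro sum_mono)
  also have "\<dots> = x"
    unfolding x atoms_star_query by (subst sum.reindex) (auto simp: inj_on_def)
  finally show "real n \<le> x"
    by simp
qed

lemma fc_width_star_query_ge:
  assumes n: "n \<ge> 1"
  shows "real n \<le> fc_width (star_query r n)"
  unfolding fc_width_def
proof (rule cINF_greatest)
  show "FTD (star_query r n) \<noteq> {}"
    by (rule FTD_nonempty[OF is_crpq_star_query[OF n]])
  fix \<T> assume "\<T> \<in> FTD (star_query r n)"
  moreover obtain T \<chi> where \<T>: "\<T> = (T, \<chi>)"
    by fastforce
  ultimately have FTD: "(T, \<chi>) \<in> FTD (star_query r n)"
    by simp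
  then obtain t where t: "t \<in> verts T" "{1..n} \<subseteq> \<chi> t"
    using star_query_leaves_in_bag[OF n] by blast
  have td: "tree_decomposition (star_query r n) T \<chi>"
    using FTD by (simp add: FTD_def)
  then have "\<chi> t \<subseteq> {0..n}"
    using t n by (auto simp: tree_decomposition_def vars_star_query)
  with n t have "real n \<le> rho_star (star_query r n) (\<chi> t)"
    by (intro rho_star_star_query_ge)
  \<comment> \<open>\<open>Max_ge\<close> requires finitely many bags, which the finite tree
    provides.\<close>
  also have "\<dots> \<le> w_decomp (star_query r n) \<T>"
    unfolding w_decomp_def using t td
    by (intro Max_ge) (auto simp: bags_def \<T> tree_decomposition_def is_tree_def)
  finally show "real n \<le> w_decomp (star_query r n) \<T>" .
qed

theorem proposition2:
  shows "\<exists>\<C> :: (nat, 'a::finite) crpq set.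
           infinite \<C> \<and>
           (\<forall>Q\<in>\<C>. is_crpq Q \<and> acyclic_crpq Q) \<and>
           (\<exists>c. \<forall>Q\<in>\<C>. cw Q \<le> c) \<and>
           (SUP Q\<in>\<C>. ereal (fc_width Q)) = \<infinity>"
proof (intro exI conjI)
  \<comment> \<open>\<open>undefined\<close> is just some letter of the alphabet. Index 0, which
    gives no CRPQ, is left out.\<close>
  let ?C = "star_query (Letter undefined) ` {1..} :: (nat, 'a) crpq set"
  show "infinite ?C"
    using finite_imageD[OF _ inj_on_subset[OF inj_star_query subset_UNIV]] infinite_Ici by blast
  show "\<forall>Q\<in>?C. is_crpq Q \<and> acyclic_crpq Q"
    by (auto simp: is_crpq_star_query acyclic_star_query)
  show "\<forall>Q\<in>?C. cw Q \<le> 1"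
    using cw_star_query_le by auto
  show "(SUP Q\<in>?C. ereal (fc_width Q)) = \<infinity>"
  proof (rule SUP_PInfty)
    fix n
    \<comment> \<open>The witness has \<open>Suc n\<close> leaves because \<open>n\<close> itself
      may be 0.\<close>
    have "real n \<le> real (Suc n)" by simp
    also have "\<dots> \<le> fc_width (star_query (Letter undefined) (Suc n) :: (nat, 'a) crpq)"
      by (rule fc_width_star_query_ge) simp
    finally have "real n \<le> fc_width (star_query (Letter undefined) (Suc n) :: (nat, 'a) crpq)" .
    then show "\<exists>Q\<in>?C. ereal (real n) \<le> ereal (fc_width Q)"
      by (intro bexI[of _ "star_query (Letter undefined) (Suc n)"]) auto
  qed
qed

end
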